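(* Let $\mathsf e\in\{\mathsf l,\mathsf w\}$. In the shuffling calculus the following hold: (1) $\to_\sigma$ satisfies $\mathsf e$-factorization: $\to_\sigma^*\subseteq\to_{\mathsf e\sigma}^*\cdot\to_{\neg\mathsf e\sigma}^*$; (2) $\to_{\neg\mathsf e\beta_v}\cdot\mapsto_\sigma\ \subseteq\ \to_{\mathsf e\sigma}\cdot\to_{\beta_v}$; (3) for $i\in\{1,3\}$, $\mapsto_{\sigma_i}$ is closed under substitution of values: $t\mapsto_{\sigma_i}t'$ implies $t\{x:=v\}\mapsto_{\sigma_i}t'\{x:=v\}$ for every variable $x$ and value $v$. Consequently $\to_{\mathsf{sh}}:=\to_{\beta_v}\cup\to_\sigma$ satisfies $\mathsf e$-factorization: $\to_{\mathsf{sh}}^*\subseteq(\to_{\mathsf e\beta_v}\cup\to_{\mathsf e\sigma})^*\cdot(\to_{\neg\mathsf e\beta_v}\cup\to_{\neg\mathsf e\sigma})^*$.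
   Context: Terms: $t::=x\mid c\mid\lambda x.t\mid tt$ modulo $\alpha$-equivalence ($c$ constants from a possibly empty set), $\mathrm{fv}(t)$ the free variables, $t\{x:=q\}$ capture-avoiding substitution. Values: $v::=x\mid c\mid\lambda x.t$. Contexts $C::=\langle\cdot\rangle\mid tC\mid Ct\mid\lambda x.C$; the contextual closure of a root relation $\mapsto_\rho$ is $C\langle r\rangle\to_\rho C\langle r'\rangle$ for $r\mapsto_\rho r'$. Rules: $(\lambda x.t)v\mapsto_{\beta_v}t\{x:=v\}$ ($v$ a value); $(\lambda x.t)us\mapsto_{\sigma_1}(\lambda x.ts)u$ if $x\notin\mathrm{fv}(s)$; $v((\lambda x.t)u)\mapsto_{\sigma_3}(\lambda x.vt)u$ if $v$ is a value and $x\notin\mathrm{fv}(v)$. $\mapsto_\sigma:=\mapsto_{\sigma_1}\cup\mapsto_{\sigma_3}$ and $\to_\sigma$ is its contextual closure. Left contexts: $L::=\langle\cdot\rangle\mid Lt\mid vL$; weak contexts: $W::=\langle\cdot\rangle\mid Wt\mid tW$. For a rule $\mapsto_\rho$, $\to_{\mathsf l\rho}$ / $\to_{\mathsf w\rho}$ is its closure under left / weak contexts, and $\to_{\neg\mathsf l\rho}$ / $\to_{\neg\mathsf w\rho}$ its closure under contexts that are not left / not weak. $\to^*$ is reflexive-transitive closure; $R\cdot S$ composition. *)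

theory Defs
  imports Main
begin

text \<open>
  Terms modulo alpha-equivalence are represented by de Bruijn terms: an index below the
  number of enclosing binders is bound, and the remaining indices are the free variables.
  The constants come from a set \<open>K\<close>, possibly empty, of an arbitrary type; since HOL
  types are nonempty, the grammars are inductively defined subsets depending on \<open>K\<close>.
\<close>

datatype 'c trm =
    Var nat
  | Const 'c
  | Lam "'c trm"
  | App "'c trm" "'c trm"

inductive_set trms :: "'c set \<Rightarrow> 'c trm set" for K :: "'c set" where
  "Var x \<in> trms K"
| "c \<in> K \<Longrightarrow> Const c \<in> trms K"
| "t \<in> trms K \<Longrightarrow> Lam t \<in> trms K"
| "t \<in> trms K \<Longrightarrow> u \<in> trms K \<Longrightarrow> App t u \<in> trms K"

inductive_set vals :: "'c set \<Rightarrow> 'c trm set" for K :: "'c set" where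
  "Var x \<in> vals K"
| "c \<in> K \<Longrightarrow> Const c \<in> vals K"
| "t \<in> trms K \<Longrightarrow> Lam t \<in> vals K"

primrec rename :: "(nat \<Rightarrow> nat) \<Rightarrow> 'c trm \<Rightarrow> 'c trm" where
  "rename f (Var i) = Var (f i)"
| "rename f (Const c) = Const c"
| "rename f (Lam t) = Lam (rename (case_nat 0 (\<lambda>i. Suc (f i))) t)"
| "rename f (App t u) = App (rename f t) (rename f u)"

text \<open>
  \<open>lift s\<close> is \<open>s\<close> moved below one additional binder. The terms of this form are exactly
  those in which the variable of that binder (index 0) does not occur free, so \<open>lift\<close>
  expresses the side conditions \<open>x \<notin> fv(s)\<close> of the rules (lemma \<open>range_lift\<close> below).
\<close>

definition lift :: "'c trm \<Rightarrow> 'c trm" where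
  "lift = rename Suc"

primrec fv :: "'c trm \<Rightarrow> nat set" where
  "fv (Var i) = {i}"
| "fv (Const c) = {}"
| "fv (Lam t) = {i. Suc i \<in> fv t}"
| "fv (App t u) = fv t \<union> fv u"

lemma ex_rename_iff:
  fixes t :: "'c trm"
  shows "(\<exists>s. t = rename f s) \<longleftrightarrow> fv t \<subseteq> range f"
proof (induction t arbitrary: f)
  case (Var i)
  let ?t = "Var i :: 'c trm"
  show ?case
  proof
    assume "fv ?t \<subseteq> range f"
    then obtain j where "i = f j" by auto
    then have "?t = rename f (Var j)" by simp
    then show "\<exists>s. ?t = rename f s" ..
  next
    assume "\<exists>s. ?t = rename f s"
    then obtain s where "?t = rename f s" ..
    then show "fv ?t \<subseteq> range f" by (cases s) auto
  qed
next
  case (Const c)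
  have "Const c = rename f (Const c)" by simp
  then have "\<exists>s. Const c = rename f s" ..
  then show ?case by simp
next
  case (Lam t)
  let ?g = "case_nat 0 (\<lambda>i. Suc (f i))"
  have g: "range ?g = insert 0 (Suc ` range f)"
  proof -
    have "(UNIV :: nat set) = insert 0 (range Suc)"
      by (auto simp: image_iff) (metis not0_implies_Suc)
    then have "range ?g = ?g ` insert 0 (range Suc)" by (rule arg_cong)
    then show ?thesis by (simp add: image_image)
  qed
  have "(\<exists>s. Lam t = rename f s) \<longleftrightarrow> (\<exists>s. t = rename ?g s)"
  proof
    assume "\<exists>s. Lam t = rename f s"
    then obtain s where "Lam t = rename f s" ..
    then show "\<exists>s. t = rename ?g s" by (cases s) auto
  next
    assume "\<exists>s. t = rename ?g s"
    then show "\<exists>s. Lam t = rename f s" by (metis rename.simps(3))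
  qed
  also have "\<dots> \<longleftrightarrow> fv t \<subseteq> range ?g" by (rule Lam.IH)
  also have "\<dots> \<longleftrightarrow> fv (Lam t) \<subseteq> range f"
    unfolding g by (auto simp: subset_iff image_iff) (metis not0_implies_Suc)
  finally show ?case .
next
  case (App t u)
  have "(\<exists>s. App t u = rename f s) \<longleftrightarrow> (\<exists>s. t = rename f s) \<and> (\<exists>s. u = rename f s)"
  proof
    assume "\<exists>s. App t u = rename f s"
    then obtain s where "App t u = rename f s" ..
    then show "(\<exists>s. t = rename f s) \<and> (\<exists>s. u = rename f s)" by (cases s) auto
  next
    assume "(\<exists>s. t = rename f s) \<and> (\<exists>s. u = rename f s)"
    then show "\<exists>s. App t u = rename f s" by (metis rename.simps(4))
  qed
  then show ?case using App.IH by simp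
qed

lemma range_lift: "range lift = {t. 0 \<notin> fv t}"
proof -
  have "t \<in> range lift \<longleftrightarrow> 0 \<notin> fv t" for t :: "'c trm"
  proof -
    have "t \<in> range lift \<longleftrightarrow> fv t \<subseteq> range Suc"
      using ex_rename_iff[of t Suc] by (auto simp: lift_def)
    also have "\<dots> \<longleftrightarrow> 0 \<notin> fv t"
      by (auto simp: subset_iff image_iff) (metis not0_implies_Suc)
    finally show ?thesis .
  qed
  then show ?thesis by auto
qed

text \<open>Capture-avoiding simultaneous substitution.\<close>

primrec msubst :: "(nat \<Rightarrow> 'c trm) \<Rightarrow> 'c trm \<Rightarrow> 'c trm" where
  "msubst s (Var i) = s i"
| "msubst s (Const c) = Const c"
| "msubst s (Lam t) = Lam (msubst (case_nat (Var 0) (\<lambda>i. lift (s i))) t)"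
| "msubst s (App t u) = App (msubst s t) (msubst s u)"

text \<open>
  \<open>subst t x q\<close> is \<open>t{x:=q}\<close> for a free variable \<open>x\<close>; all other variables stay fixed.
  \<open>inst t q\<close> is \<open>t{x:=q}\<close> where \<open>x\<close> is the variable bound by the removed binder of
  \<open>Lam t\<close>: index 0 becomes \<open>q\<close>, and the other indices drop by one.
\<close>

definition subst :: "'c trm \<Rightarrow> nat \<Rightarrow> 'c trm \<Rightarrow> 'c trm" where
  "subst t x q = msubst (Var(x := q)) t"

definition inst :: "'c trm \<Rightarrow> 'c trm \<Rightarrow> 'c trm" where
  "inst t q = msubst (case_nat q Var) t"

datatype 'c ctx =
    Hole
  | CAppR "'c trm" "'c ctx"
  | CAppL "'c ctx" "'c trm"
  | CLam "'c ctx"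

text \<open>Plugging is literal, hence binders of the context capture variables of the plugged term.\<close>

primrec plug :: "'c ctx \<Rightarrow> 'c trm \<Rightarrow> 'c trm" where
  "plug Hole r = r"
| "plug (CAppR t C) r = App t (plug C r)"
| "plug (CAppL C t) r = App (plug C r) t"
| "plug (CLam C) r = Lam (plug C r)"

inductive_set ctxs :: "'c set \<Rightarrow> 'c ctx set" for K :: "'c set" where
  "Hole \<in> ctxs K"
| "t \<in> trms K \<Longrightarrow> C \<in> ctxs K \<Longrightarrow> CAppR t C \<in> ctxs K"
| "C \<in> ctxs K \<Longrightarrow> t \<in> trms K \<Longrightarrow> CAppL C t \<in> ctxs K"
| "C \<in> ctxs K \<Longrightarrow> CLam C \<in> ctxs K"

inductive_set left_ctxs :: "'c set \<Rightarrow> 'c ctx set" for K :: "'c set" where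
  "Hole \<in> left_ctxs K"
| "L \<in> left_ctxs K \<Longrightarrow> t \<in> trms K \<Longrightarrow> CAppL L t \<in> left_ctxs K"
| "v \<in> vals K \<Longrightarrow> L \<in> left_ctxs K \<Longrightarrow> CAppR v L \<in> left_ctxs K"

inductive_set weak_ctxs :: "'c set \<Rightarrow> 'c ctx set" for K :: "'c set" where
  "Hole \<in> weak_ctxs K"
| "W \<in> weak_ctxs K \<Longrightarrow> t \<in> trms K \<Longrightarrow> CAppL W t \<in> weak_ctxs K"
| "t \<in> trms K \<Longrightarrow> W \<in> weak_ctxs K \<Longrightarrow> CAppR t W \<in> weak_ctxs K"

definition root_betav :: "'c set \<Rightarrow> 'c trm rel" where
  "root_betav K = {(App (Lam t) v, inst t v) | t v. t \<in> trms K \<and> v \<in> vals K}"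

definition root_sigma1 :: "'c set \<Rightarrow> 'c trm rel" where
  "root_sigma1 K =
    {(App (App (Lam t) u) s, App (Lam (App t (lift s))) u) | t u s.
      t \<in> trms K \<and> u \<in> trms K \<and> s \<in> trms K}"

definition root_sigma3 :: "'c set \<Rightarrow> 'c trm rel" where
  "root_sigma3 K =
    {(App v (App (Lam t) u), App (Lam (App (lift v) t)) u) | v t u.
      v \<in> vals K \<and> t \<in> trms K \<and> u \<in> trms K}"

definition root_sigma :: "'c set \<Rightarrow> 'c trm rel" where
  "root_sigma K = root_sigma1 K \<union> root_sigma3 K"

definition closure :: "'c ctx set \<Rightarrow> 'c trm rel \<Rightarrow> 'c trm rel" where
  "closure E R = {(plug C r, plug C r') | C r r'. C \<in> E \<and> (r, r') \<in> R}"

definition step :: "'c set \<Rightarrow> 'c trm rel \<Rightarrow> 'c trm rel" where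
  "step K R = closure (ctxs K) R"

definition nonstep :: "'c set \<Rightarrow> 'c ctx set \<Rightarrow> 'c trm rel \<Rightarrow> 'c trm rel" where
  "nonstep K E R = closure (ctxs K - E) R"

definition step_sh :: "'c set \<Rightarrow> 'c trm rel" where
  "step_sh K = step K (root_betav K) \<union> step K (root_sigma K)"

end

theory Submission
  imports Defs
begin

text \<open>
  A step outside evaluation contexts cannot create a root \<open>\<sigma>\<close>-redex, so it commutes past an
  evaluation \<open>\<sigma>\<close>-step and, since a \<open>\<sigma>\<close>-step never produces a value, a non-evaluation
  \<open>\<sigma>\<close>-step stays non-evaluation; this factorizes \<open>\<sigma>\<close>. For \<open>\<beta>\<^sub>v\<close>, Takahashi's argument
  applies: parallel reduction splits into evaluation steps followed by an internal parallel step,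
  and an internal parallel step followed by an evaluation step merges into a parallel step.
  As values are closed under substitution of values, splitting needs no count of the contracted
  redexes. Finally, a non-evaluation step of either rule swaps with an evaluation step of the
  other without duplicating the latter, which lifts the two factorizations to the union.
\<close>

section \<open>Postponement in abstract rewriting\<close>

text \<open>Passing one \<open>R\<close> step leaves \<open>I\<close> a single step, so it can be
  pushed past a whole \<open>R\<close> sequence one step at a time.\<close>

lemma postpone_rtrancl_right:
  assumes "I O R \<subseteq> R\<^sup>* O I"
  shows "I O R\<^sup>* \<subseteq> R\<^sup>* O I"
proof -
  have "(b, c) \<in> R\<^sup>* \<Longrightarrow> (a, b) \<in> I \<Longrightarrow> (a, c) \<in> R\<^sup>* O I" for a b c
  proof (induction rule: rtrancl_induct)
    case (step y z)
    then obtain d where d: "(a, d) \<in> R\<^sup>*" "(d, y) \<in> I" by blast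
    with step have "(d, z) \<in> R\<^sup>* O I" using assms by blast
    with d show ?case by (meson relcomp.cases relcomp.intros rtrancl_trans)
  qed auto
  then show ?thesis by blast
qed

text \<open>Steps are prepended to an already factorized remainder: a leading \<open>R\<close> step
  joins the prefix, a leading \<open>I\<close> step crosses the whole prefix.\<close>

lemma factorization_if_postpone:
  assumes "I O R \<subseteq> R\<^sup>* O I"
  shows "(R \<union> I)\<^sup>* \<subseteq> R\<^sup>* O I\<^sup>*"
proof -
  have "(a, c) \<in> (R \<union> I)\<^sup>* \<Longrightarrow> (a, c) \<in> R\<^sup>* O I\<^sup>*" for a c
  proof (induction rule: converse_rtrancl_induct)
    case (step y z)
    then obtain d where d: "(z, d) \<in> R\<^sup>*" "(d, c) \<in> I\<^sup>*" by blast
    from step(1) show ?case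
    proof
      assume "(y, z) \<in> R"
      with d show ?thesis by (meson converse_rtrancl_into_rtrancl relcomp.intros)
    next
      assume "(y, z) \<in> I"
      with d have "(y, d) \<in> R\<^sup>* O I" using postpone_rtrancl_right[OF assms] by blast
      with d show ?thesis by (meson converse_rtrancl_into_rtrancl relcomp.cases relcomp.intros)
    qed
  qed auto
  then show ?thesis by auto
qed

text \<open>The \<open>S\<close> step is never duplicated by a swap, so it travels through any
  number of \<open>I\<close> steps. What it leaves behind consists of \<open>R\<close> and
  \<open>I\<close> steps only, which \<open>fact\<close> sorts again.\<close>

lemma linear_swap_rtrancl:
  assumes swap: "I O S \<subseteq> S O (R \<union> I)\<^sup>*"
    and fact: "(R \<union> I)\<^sup>* \<subseteq> R\<^sup>* O I\<^sup>*"
  shows "I\<^sup>* O (R \<union> S) \<subseteq> (R \<union> S)\<^sup>* O I\<^sup>*"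
proof -
  have sub: "R\<^sup>* \<subseteq> (R \<union> S)\<^sup>*" by (rule rtrancl_mono) simp
  have I: "I\<^sup>* \<subseteq> (R \<union> I)\<^sup>*" by (rule rtrancl_mono) simp
  have "(a, b) \<in> I\<^sup>* \<Longrightarrow> (b, c) \<in> S \<Longrightarrow> (a, c) \<in> S O (R \<union> I)\<^sup>*" for a b c
  proof (induction rule: converse_rtrancl_induct)
    case (step y z)
    then obtain d where d: "(z, d) \<in> S" "(d, c) \<in> (R \<union> I)\<^sup>*" by blast
    with step have "(y, d) \<in> S O (R \<union> I)\<^sup>*" using swap by blast
    with d show ?case by (meson relcomp.cases relcomp.intros rtrancl_trans)
  qed auto
  then have "I\<^sup>* O S \<subseteq> S O (R \<union> I)\<^sup>*" by auto
  also have "\<dots> \<subseteq> S O (R\<^sup>* O I\<^sup>*)" by (rule relcomp_mono[OF subset_refl fact])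
  also have "\<dots> \<subseteq> (R \<union> S)\<^sup>* O I\<^sup>*"
  proof -
    have "S O R\<^sup>* \<subseteq> (R \<union> S)\<^sup>* O (R \<union> S)\<^sup>*" by (rule relcomp_mono[OF _ sub]) auto
    then have "S O R\<^sup>* \<subseteq> (R \<union> S)\<^sup>*" by simp
    then show ?thesis unfolding O_assoc[symmetric] by (rule relcomp_mono) simp
  qed
  finally have "I\<^sup>* O S \<subseteq> (R \<union> S)\<^sup>* O I\<^sup>*" .
  moreover have "I\<^sup>* O R \<subseteq> (R \<union> I)\<^sup>*"
    using I by (meson UnI1 relcomp.cases rtrancl.rtrancl_into_rtrancl subrelI subsetD)
  then have "I\<^sup>* O R \<subseteq> (R \<union> S)\<^sup>* O I\<^sup>*" using fact sub by blast
  ultimately show ?thesis by blast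
qed

text \<open>Two factorizations combine when each internal relation swaps linearly with the
  evaluation relation of the other system.\<close>

lemma modular_factorization:
  assumes fa: "(R \<union> I)\<^sup>* \<subseteq> R\<^sup>* O I\<^sup>*"
    and fc: "(S \<union> J)\<^sup>* \<subseteq> S\<^sup>* O J\<^sup>*"
    and swap1: "I O S \<subseteq> S O (R \<union> I)\<^sup>*"
    and swap2: "J O R \<subseteq> R O (S \<union> J)\<^sup>*"
  shows "((R \<union> S) \<union> (I \<union> J))\<^sup>* \<subseteq> (R \<union> S)\<^sup>* O (I \<union> J)\<^sup>*"
proof -
  have "I\<^sup>* O (R \<union> S) \<subseteq> (R \<union> S)\<^sup>* O I\<^sup>*"
    by (rule linear_swap_rtrancl[OF swap1 fa])
  moreover have "J\<^sup>* O (R \<union> S) \<subseteq> (R \<union> S)\<^sup>* O J\<^sup>*"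
    using linear_swap_rtrancl[OF swap2 fc] by (simp add: Un_commute)
  \<comment> \<open>A swap may turn one internal step into many. Counting a whole \<open>I\<close>
    or \<open>J\<close> sequence as one internal step gives exactly the form that the postponement
    criterion requires.\<close>
  ultimately have "(I\<^sup>* \<union> J\<^sup>*) O (R \<union> S) \<subseteq> (R \<union> S)\<^sup>* O (I\<^sup>* \<union> J\<^sup>*)" by blast
  then have "((R \<union> S) \<union> (I\<^sup>* \<union> J\<^sup>*))\<^sup>* \<subseteq> (R \<union> S)\<^sup>* O (I\<^sup>* \<union> J\<^sup>*)\<^sup>*"
    by (rule factorization_if_postpone)
  moreover have "((R \<union> S) \<union> (I \<union> J))\<^sup>* \<subseteq> ((R \<union> S) \<union> (I\<^sup>* \<union> J\<^sup>*))\<^sup>*"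
    by (rule rtrancl_mono) auto
  ultimately show ?thesis by (simp add: rtrancl_Un_rtrancl)
qed

section \<open>Substitution\<close>

abbreviation up_ren :: "(nat \<Rightarrow> nat) \<Rightarrow> nat \<Rightarrow> nat" where
  "up_ren f \<equiv> case_nat 0 (\<lambda>i. Suc (f i))"

abbreviation up :: "(nat \<Rightarrow> 'c trm) \<Rightarrow> nat \<Rightarrow> 'c trm" where
  "up s \<equiv> case_nat (Var 0) (\<lambda>i. lift (s i))"

lemma rename_rename: "rename f (rename g t) = rename (f \<circ> g) t"
proof (induction t arbitrary: f g)
  case (Lam t)
  have "up_ren f \<circ> up_ren g = up_ren (f \<circ> g)"
    by (auto split: nat.split)
  with Lam show ?case by (simp add: comp_def)
qed simp_all

lemma rename_lift: "rename (up_ren f) (lift t) = lift (rename f t)"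
  by (simp add: lift_def rename_rename comp_def)

lemma msubst_rename: "msubst s (rename f t) = msubst (s \<circ> f) t"
proof (induction t arbitrary: s f)
  case (Lam t)
  have "up s \<circ> up_ren f = up (s \<circ> f)"
    by (auto split: nat.split)
  with Lam show ?case by (simp add: comp_def)
qed simp_all

lemma rename_msubst: "rename f (msubst s t) = msubst (rename f \<circ> s) t"
proof (induction t arbitrary: s f)
  case (Lam t)
  have "rename (up_ren f) \<circ> up s = up (rename f \<circ> s)"
    by (auto split: nat.split simp: rename_lift)
  with Lam show ?case by (simp add: comp_def)
qed simp_all

lemma msubst_lift: "msubst (up s) (lift t) = lift (msubst s t)"
  by (simp add: lift_def msubst_rename rename_msubst comp_def)

lemma msubst_msubst: "msubst s (msubst s' t) = msubst (msubst s \<circ> s') t"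
proof (induction t arbitrary: s s')
  case (Lam t)
  have "msubst (up s) \<circ> up s' = up (msubst s \<circ> s')"
    by (auto split: nat.split simp: msubst_lift)
  with Lam show ?case by (simp add: comp_def)
qed simp_all

lemma rename_eq_msubst:
  fixes t :: "'c trm"
  shows "rename f t = msubst (Var \<circ> f) t"
proof (induction t arbitrary: f)
  case (Lam t)
  have "(Var :: _ \<Rightarrow> 'c trm) \<circ> up_ren f = up (Var \<circ> f)"
    by (auto split: nat.split simp: lift_def)
  with Lam show ?case by (simp add: comp_def)
qed simp_all

lemma lift_eq_msubst: "lift t = msubst (Var \<circ> Suc) t"
  by (simp add: lift_def rename_eq_msubst)

lemma msubst_Var:
  fixes t :: "'c trm"
  shows "msubst Var t = t"
proof (induction t)
  case (Lam t)
  have "up Var = (Var :: _ \<Rightarrow> 'c trm)"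
    by (auto split: nat.split simp: lift_def)
  with Lam show ?case by simp
qed simp_all

text \<open>The substitution lemma: composing on both sides reduces it to a comparison of two
  substitutions at each index.\<close>

lemma msubst_inst: "msubst s (inst t q) = inst (msubst (up s) t) (msubst s q)"
proof -
  have "msubst s \<circ> case_nat q Var = msubst (case_nat (msubst s q) Var) \<circ> up s"
  proof
    fix i
    \<comment> \<open>Index 0 does not occur in a lifted term, so instantiating it only undoes the
      shift.\<close>
    have "msubst (case_nat a Var) (lift u) = u" for a u :: "'a trm"
      by (simp add: lift_def msubst_rename comp_def msubst_Var)
    then show "(msubst s \<circ> case_nat q Var) i = (msubst (case_nat (msubst s q) Var) \<circ> up s) i"
      by (simp split: nat.split)
  qed
  then show ?thesis by (simp add: inst_def msubst_msubst)
qed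

lemma rename_inst:
  fixes t :: "'c trm"
  shows "rename f (inst t q) = inst (rename (up_ren f) t) (rename f q)"
proof -
  have "(Var :: _ \<Rightarrow> 'c trm) \<circ> up_ren f = up (Var \<circ> f)"
    by (auto split: nat.split simp: lift_def)
  then show ?thesis
    by (simp only: rename_eq_msubst msubst_inst)
qed

section \<open>Well-formed terms, values and substitution of values\<close>

declare trms.intros[simp, intro] vals.intros[simp, intro]

lemma trms_iff [simp]:
  "Const c \<in> trms K \<longleftrightarrow> c \<in> K"
  "Lam t \<in> trms K \<longleftrightarrow> t \<in> trms K"
  "App t u \<in> trms K \<longleftrightarrow> t \<in> trms K \<and> u \<in> trms K"
  by (auto elim: trms.cases)

lemma vals_iff [simp]:
  "Const c \<in> vals K \<longleftrightarrow> c \<in> K"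
  "Lam t \<in> vals K \<longleftrightarrow> t \<in> trms K"
  "App t u \<notin> vals K"
  by (auto elim: vals.cases)

lemma vals_trms: "v \<in> vals K \<Longrightarrow> v \<in> trms K"
  by (auto elim: vals.cases)

text \<open>Simultaneous substitutions are stable under passing binders, and they cover single
  substitution of a value, instantiation of a binder by a value, and renaming, since variables are
  values.\<close>

definition val_subst :: "'c set \<Rightarrow> (nat \<Rightarrow> 'c trm) \<Rightarrow> bool" where
  "val_subst K s \<longleftrightarrow> (\<forall>i. s i \<in> vals K)"

lemma val_substD: "val_subst K s \<Longrightarrow> s i \<in> vals K"
  by (simp add: val_subst_def)

lemma rename_trms: "t \<in> trms K \<Longrightarrow> rename f t \<in> trms K"
  by (induction t arbitrary: f) auto

lemma rename_vals: "t \<in> vals K \<Longrightarrow> rename f t \<in> vals K"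
  by (cases t) (auto simp: rename_trms)

lemma lift_trms [simp]: "t \<in> trms K \<Longrightarrow> lift t \<in> trms K"
  by (simp add: lift_def rename_trms)

lemma lift_vals [simp]: "t \<in> vals K \<Longrightarrow> lift t \<in> vals K"
  by (simp add: lift_def rename_vals)

lemma val_subst_up [simp]: "val_subst K s \<Longrightarrow> val_subst K (up s)"
  by (auto simp: val_subst_def split: nat.split)

lemma val_subst_Var [simp]: "val_subst K (Var \<circ> f)"
  by (simp add: val_subst_def)

lemma val_subst_inst [simp]: "v \<in> vals K \<Longrightarrow> val_subst K (case_nat v Var)"
  by (auto simp: val_subst_def split: nat.split)

lemma msubst_trms [simp]: "t \<in> trms K \<Longrightarrow> val_subst K s \<Longrightarrow> msubst s t \<in> trms K"
  by (induction t arbitrary: s) (auto intro: vals_trms val_substD)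

lemma msubst_vals [simp]: "t \<in> vals K \<Longrightarrow> val_subst K s \<Longrightarrow> msubst s t \<in> vals K"
  by (cases t) (auto dest: val_substD)

lemma inst_trms [simp]: "t \<in> trms K \<Longrightarrow> v \<in> vals K \<Longrightarrow> inst t v \<in> trms K"
  by (simp add: inst_def)

definition val_subst_closed :: "'c set \<Rightarrow> 'c trm rel \<Rightarrow> bool" where
  "val_subst_closed K R \<longleftrightarrow>
    (\<forall>s t t'. val_subst K s \<longrightarrow> (t, t') \<in> R \<longrightarrow> (msubst s t, msubst s t') \<in> R)"

lemma val_subst_closedD:
  "val_subst_closed K R \<Longrightarrow> val_subst K s \<Longrightarrow> (t, t') \<in> R \<Longrightarrow> (msubst s t, msubst s t') \<in> R"
  unfolding val_subst_closed_def by blast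

lemma val_subst_closed_sigma1: "val_subst_closed K (root_sigma1 K)"
  by (auto simp: val_subst_closed_def root_sigma1_def msubst_lift)

lemma val_subst_closed_sigma3: "val_subst_closed K (root_sigma3 K)"
  by (auto simp: val_subst_closed_def root_sigma3_def msubst_lift)

lemma val_subst_closed_sigma: "val_subst_closed K (root_sigma K)"
  using val_subst_closed_sigma1 val_subst_closed_sigma3
  unfolding val_subst_closed_def root_sigma_def by blast

lemma val_subst_closed_betav: "val_subst_closed K (root_betav K)"
  unfolding val_subst_closed_def root_betav_def
  using msubst_inst msubst_trms msubst_vals val_subst_up by fastforce

lemma root_sigma_trms: "root_sigma K \<subseteq> trms K \<times> trms K"
  by (auto simp: root_sigma_def root_sigma1_def root_sigma3_def vals_trms)

lemma root_betav_trms: "root_betav K \<subseteq> trms K \<times> trms K"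
  by (auto simp: root_betav_def vals_trms)

section \<open>Closures as inductive relations\<close>

text \<open>The full contextual closure without contexts, so that steps can be analysed by rule
  induction and inversion.\<close>

inductive_set cstep :: "'c set \<Rightarrow> 'c trm rel \<Rightarrow> 'c trm rel" for K R where
  root: "(t, t') \<in> R \<Longrightarrow> (t, t') \<in> cstep K R"
| lam: "(t, t') \<in> cstep K R \<Longrightarrow> (Lam t, Lam t') \<in> cstep K R"
| appL: "(t, t') \<in> cstep K R \<Longrightarrow> u \<in> trms K \<Longrightarrow> (App t u, App t' u) \<in> cstep K R"
| appR: "(u, u') \<in> cstep K R \<Longrightarrow> t \<in> trms K \<Longrightarrow> (App t u, App t u') \<in> cstep K R"

text \<open>
  The parameter \<open>V\<close> is the set of terms allowed to the left of the hole in an application: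
  \<open>V = vals K\<close> gives the left contexts and \<open>V = trms K\<close> the weak ones.
\<close>

inductive_set ectxs :: "'c set \<Rightarrow> 'c trm set \<Rightarrow> 'c ctx set" for K V where
  hole: "Hole \<in> ectxs K V"
| appL: "C \<in> ectxs K V \<Longrightarrow> t \<in> trms K \<Longrightarrow> CAppL C t \<in> ectxs K V"
| appR: "t \<in> V \<Longrightarrow> C \<in> ectxs K V \<Longrightarrow> CAppR t C \<in> ectxs K V"

inductive_set estep :: "'c set \<Rightarrow> 'c trm set \<Rightarrow> 'c trm rel \<Rightarrow> 'c trm rel" for K V R where
  root: "(t, t') \<in> R \<Longrightarrow> (t, t') \<in> estep K V R"
| appL: "(t, t') \<in> estep K V R \<Longrightarrow> u \<in> trms K \<Longrightarrow> (App t u, App t' u) \<in> estep K V R"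
| appR: "(u, u') \<in> estep K V R \<Longrightarrow> t \<in> V \<Longrightarrow> (App t u, App t u') \<in> estep K V R"

text \<open>A context fails to be an evaluation context at an abstraction or to the right of a term
  outside \<open>V\<close>. Beyond such a point the step is arbitrary, hence the
  \<open>cstep\<close> premises of \<open>lam\<close> and \<open>appR_any\<close>.\<close>

inductive_set istep :: "'c set \<Rightarrow> 'c trm set \<Rightarrow> 'c trm rel \<Rightarrow> 'c trm rel" for K V R where
  lam: "(t, t') \<in> cstep K R \<Longrightarrow> (Lam t, Lam t') \<in> istep K V R"
| appL: "(t, t') \<in> istep K V R \<Longrightarrow> u \<in> trms K \<Longrightarrow> (App t u, App t' u) \<in> istep K V R"
| appR: "(u, u') \<in> istep K V R \<Longrightarrow> t \<in> V \<Longrightarrow> (App t u, App t u') \<in> istep K V R"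
| appR_any: "(u, u') \<in> cstep K R \<Longrightarrow> t \<in> trms K \<Longrightarrow> t \<notin> V \<Longrightarrow> (App t u, App t u') \<in> istep K V R"

lemma left_ctxs_eq: "left_ctxs K = ectxs K (vals K)"
proof -
  have "C \<in> ectxs K (vals K)" if "C \<in> left_ctxs K" for C
    using that by induction (auto intro: ectxs.intros)
  moreover have "C \<in> left_ctxs K" if "C \<in> ectxs K (vals K)" for C
    using that by induction (auto intro: left_ctxs.intros)
  ultimately show ?thesis by blast
qed

lemma weak_ctxs_eq: "weak_ctxs K = ectxs K (trms K)"
proof -
  have "C \<in> ectxs K (trms K)" if "C \<in> weak_ctxs K" for C
    using that by induction (auto intro: ectxs.intros)
  moreover have "C \<in> weak_ctxs K" if "C \<in> ectxs K (trms K)" for C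
    using that by induction (auto intro: weak_ctxs.intros)
  ultimately show ?thesis by blast
qed

lemma ctxs_iff [simp]:
  "Hole \<in> ctxs K"
  "CLam C \<in> ctxs K \<longleftrightarrow> C \<in> ctxs K"
  "CAppL C t \<in> ctxs K \<longleftrightarrow> C \<in> ctxs K \<and> t \<in> trms K"
  "CAppR t C \<in> ctxs K \<longleftrightarrow> C \<in> ctxs K \<and> t \<in> trms K"
  by (auto intro: ctxs.intros elim: ctxs.cases)

lemma ectxs_iff [simp]:
  "Hole \<in> ectxs K V"
  "CLam C \<notin> ectxs K V"
  "CAppL C t \<in> ectxs K V \<longleftrightarrow> C \<in> ectxs K V \<and> t \<in> trms K"
  "CAppR t C \<in> ectxs K V \<longleftrightarrow> C \<in> ectxs K V \<and> t \<in> V"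
  by (auto intro: ectxs.intros elim: ectxs.cases)

lemma step_eq: "step K R = cstep K R"
proof -
  have "(plug C r, plug C r') \<in> cstep K R" if "C \<in> ctxs K" "(r, r') \<in> R" for C r r'
    using that by (induction C) (auto intro: cstep.intros)
  moreover have "\<exists>C r r'. C \<in> ctxs K \<and> (r, r') \<in> R \<and> t = plug C r \<and> t' = plug C r'"
    if "(t, t') \<in> cstep K R" for t t'
    using that
  proof induction
    case (root t t')
    then show ?case by (metis ctxs_iff(1) plug.simps(1))
  next
    case (lam t t')
    then show ?case by (metis ctxs_iff(2) plug.simps(4))
  next
    case (appL t t' u)
    then show ?case by (metis ctxs_iff(3) plug.simps(3))
  next
    case (appR u u' t)
    then show ?case by (metis ctxs_iff(4) plug.simps(2))
  qed
  ultimately show ?thesis unfolding step_def closure_def by fastforce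
qed

lemma closure_ectxs_eq: "closure (ectxs K V) R = estep K V R"
proof -
  have "(plug C r, plug C r') \<in> estep K V R" if "C \<in> ectxs K V" "(r, r') \<in> R" for C r r'
    using that by (induction C) (auto intro: estep.intros)
  moreover have "\<exists>C r r'. C \<in> ectxs K V \<and> (r, r') \<in> R \<and> t = plug C r \<and> t' = plug C r'"
    if "(t, t') \<in> estep K V R" for t t'
    using that
  proof induction
    case (root t t')
    then show ?case by (metis ectxs_iff(1) plug.simps(1))
  next
    case (appL t t' u)
    then show ?case by (metis ectxs_iff(3) plug.simps(3))
  next
    case (appR u u' t)
    then show ?case by (metis ectxs_iff(4) plug.simps(2))
  qed
  ultimately show ?thesis unfolding closure_def by fastforce
qed

text \<open>The delicate context is \<open>CAppR t C\<close>: with \<open>t\<close> in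
  \<open>V\<close> it is non-evaluation exactly if \<open>C\<close> is, with \<open>t\<close>
  outside \<open>V\<close> it always is. The rules \<open>appR\<close> and \<open>appR_any\<close>
  reflect this split.\<close>

lemma nonstep_eq:
  assumes "V \<subseteq> trms K"
  shows "nonstep K (ectxs K V) R = istep K V R"
proof -
  have c: "(plug C r, plug C r') \<in> cstep K R" if "C \<in> ctxs K" "(r, r') \<in> R" for C r r'
    using that by (induction C) (auto intro: cstep.intros)
  have "(plug C r, plug C r') \<in> istep K V R"
    if "C \<in> ctxs K" "C \<notin> ectxs K V" "(r, r') \<in> R" for C r r'
    using that
  proof (induction C rule: ctx.induct)
    case (CAppR t C)
    then show ?case using c by (cases "t \<in> V") (auto intro: istep.intros)
  qed (auto intro: istep.intros c)
  moreover have "\<exists>C r r'. C \<in> ctxs K \<and> C \<notin> ectxs K V \<and> (r, r') \<in> R \<and> t = plug C r \<and> t' = plug C r'"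
    if "(t, t') \<in> istep K V R" for t t'
    using that
  proof induction
    case (lam t t')
    then show ?case unfolding step_eq[symmetric] step_def closure_def
      by clarify (metis ctxs_iff(2) ectxs_iff(2) plug.simps(4))
  next
    case (appL t t' u)
    then show ?case by (metis ctxs_iff(3) ectxs_iff(3) plug.simps(3))
  next
    case (appR u u' t)
    then obtain C r r' where "C \<in> ctxs K" "C \<notin> ectxs K V" "(r, r') \<in> R"
      "u = plug C r" "u' = plug C r'" by blast
    then show ?case using assms \<open>t \<in> V\<close>
      by (intro exI[of _ "CAppR t C"] exI[of _ r] exI[of _ r']) auto
  next
    case (appR_any u u' t)
    then show ?case unfolding step_eq[symmetric] step_def closure_def
      by clarify (metis ctxs_iff(4) ectxs_iff(4) plug.simps(2))
  qed
  ultimately show ?thesis unfolding nonstep_def closure_def by fastforce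
qed

section \<open>Substitution and congruence for the full closure\<close>

lemma cstep_trms:
  assumes "R \<subseteq> trms K \<times> trms K" "(t, t') \<in> cstep K R"
  shows "t \<in> trms K \<and> t' \<in> trms K"
  using assms(2) by induction (use assms(1) in auto)

lemma cstep_msubst:
  assumes "val_subst_closed K R" "(t, t') \<in> cstep K R" "val_subst K s"
  shows "(msubst s t, msubst s t') \<in> cstep K R"
  using assms(2,3)
  by (induction arbitrary: s) (auto intro: cstep.intros val_subst_closedD[OF assms(1)])

lemma cstep_lift:
  "val_subst_closed K R \<Longrightarrow> (t, t') \<in> cstep K R \<Longrightarrow> (lift t, lift t') \<in> cstep K R"
  by (simp add: lift_eq_msubst cstep_msubst)

lemma cstep_rtrancl_cong:
  "(t, t') \<in> (cstep K R)\<^sup>* \<Longrightarrow> (Lam t, Lam t') \<in> (cstep K R)\<^sup>*"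
  "(t, t') \<in> (cstep K R)\<^sup>* \<Longrightarrow> u \<in> trms K \<Longrightarrow> (App t u, App t' u) \<in> (cstep K R)\<^sup>*"
  "(t, t') \<in> (cstep K R)\<^sup>* \<Longrightarrow> u \<in> trms K \<Longrightarrow> (App u t, App u t') \<in> (cstep K R)\<^sup>*"
  by (induction rule: rtrancl_induct; blast intro: cstep.intros rtrancl_into_rtrancl)+

text \<open>Every occurrence of a variable contributes its own copy of the reduction, so the result
  is a sequence of steps. This handles an argument that reduces before being substituted.\<close>

lemma cstep_rtrancl_msubst_pointwise:
  assumes "val_subst_closed K R" "t \<in> trms K" "val_subst K s" "val_subst K s'"
    "\<And>i. (s i, s' i) \<in> (cstep K R)\<^sup>*"
  shows "(msubst s t, msubst s' t) \<in> (cstep K R)\<^sup>*"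
  using assms(2-)
proof (induction t arbitrary: s s')
  \<comment> \<open>Cases 3 and 4 of the rule induction on \<open>trms K\<close> are abstraction and
    application.\<close>
  case (3 t)
  have "(lift a, lift b) \<in> (cstep K R)\<^sup>*" if "(a, b) \<in> (cstep K R)\<^sup>*" for a b
    using that by induction (auto intro: rtrancl_into_rtrancl cstep_lift[OF assms(1)])
  then have "(up s i, up s' i) \<in> (cstep K R)\<^sup>*" for i
    using 3 by (simp split: nat.split)
  then show ?case using 3 by (simp add: cstep_rtrancl_cong(1))
next
  case (4 t u)
  then show ?case by simp (meson cstep_rtrancl_cong(2,3) msubst_trms rtrancl_trans)
qed auto

text \<open>Left and weak evaluation are treated at once: they differ only in which operators permit
  evaluation of the operand.\<close>

locale evaluation =
  fixes K :: "'c set" and V :: "'c trm set"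
  assumes V: "V = vals K \<or> V = trms K"
begin

lemma V_trms: "V \<subseteq> trms K"
  using V vals_trms by blast

lemma vals_V: "vals K \<subseteq> V"
  using V vals_trms by blast

text \<open>Substituting values sends variables to values and keeps abstractions and applications
  what they are, so no term gains or loses the status of a value.\<close>

lemma msubst_V_iff:
  assumes "val_subst K s" "t \<in> trms K"
  shows "msubst s t \<in> V \<longleftrightarrow> t \<in> V"
proof (cases "V = trms K")
  case False
  then show ?thesis using V assms by (cases t) (auto simp: val_substD)
qed (use assms in simp)

lemma estep_cstep: "(t, t') \<in> estep K V R \<Longrightarrow> (t, t') \<in> cstep K R"
  by (induction rule: estep.induct) (use V_trms in \<open>auto intro: cstep.intros\<close>)

lemma istep_cstep: "(t, t') \<in> istep K V R \<Longrightarrow> (t, t') \<in> cstep K R"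
  by (induction rule: istep.induct) (use V_trms in \<open>auto intro: cstep.intros\<close>)

lemma cstep_split: "cstep K R = estep K V R \<union> istep K V R"
proof -
  have "(t, t') \<in> estep K V R \<union> istep K V R" if "(t, t') \<in> cstep K R" for t t'
    using that
  proof induction
    case (appR u u' t)
    then show ?case by (cases "t \<in> V") (auto intro: estep.intros istep.intros)
  qed (auto intro: estep.intros istep.intros)
  then show ?thesis using estep_cstep istep_cstep by fast
qed

lemma estep_msubst:
  assumes "val_subst_closed K R" "(t, t') \<in> estep K V R" "val_subst K s"
  shows "(msubst s t, msubst s t') \<in> estep K V R"
  using assms(2)
  by induction
    (use assms(1,3) V_trms in \<open>auto intro!: estep.appL estep.appR
      intro: estep.root val_subst_closedD simp: msubst_V_iff subset_iff\<close>)

lemma istep_to_Lam: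
  assumes "(t, Lam p) \<in> istep K V R"
  obtains q where "t = Lam q" "(q, p) \<in> cstep K R"
  using assms by (cases rule: istep.cases) auto

text \<open>Every rule for internal steps except \<open>lam\<close> yields an application, so a
  value can only be reached from an abstraction by a step in its body. Internal steps thus create no
  values.\<close>

lemma istep_to_val:
  assumes "(t, v) \<in> istep K V R" "v \<in> vals K" "R \<subseteq> trms K \<times> trms K"
  obtains q p where "t = Lam q" "v = Lam p" "(q, p) \<in> cstep K R" "t \<in> vals K"
  using assms(1)
proof (cases rule: istep.cases)
  case (lam q p)
  then show ?thesis using that assms(2) cstep_trms[OF assms(3)] by auto
qed (use assms(2) in auto)

lemma istep_to_V:
  assumes "(t, t') \<in> istep K V R" "t' \<in> V" "R \<subseteq> trms K \<times> trms K"
  shows "t \<in> V"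
proof (cases "V = trms K")
  case True
  then show ?thesis using assms cstep_trms istep_cstep by metis
next
  case False
  then show ?thesis using assms V istep_to_val by metis
qed

lemma istep_to_App:
  assumes "(t, App a b) \<in> istep K V R"
  obtains (left) c where "t = App c b" "(c, a) \<in> istep K V R" "b \<in> trms K"
  | (right) c where "t = App a c" "(c, b) \<in> istep K V R" "a \<in> V"
  | (right_any) c where "t = App a c" "(c, b) \<in> cstep K R" "a \<in> trms K" "a \<notin> V"
  using assms by (cases rule: istep.cases) auto

text \<open>The operator is an abstraction and hence in \<open>V\<close>, so a step in the operand
  must itself be internal.\<close>

lemma istep_to_redex:
  assumes "(t, App (Lam p) u) \<in> istep K V R"
  obtains (left) q where "t = App (Lam q) u" "(q, p) \<in> cstep K R" "u \<in> trms K"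
  | (right) c where "t = App (Lam p) c" "(c, u) \<in> istep K V R" "p \<in> trms K"
  using assms
proof (cases rule: istep_to_App)
  case (left c)
  then show ?thesis using that(1) by (auto elim: istep_to_Lam)
next
  case (right c)
  then show ?thesis using that(2) V_trms by auto
next
  case (right_any c)
  then show ?thesis using vals_V by auto
qed

section \<open>Swaps of steps\<close>

text \<open>The \<sigma> pattern is already present before the internal step, which acts inside one
  of its components. Contracting the pattern moves each component without copying or erasing it, so
  exactly one step remains, and its new position is again internal. The relation \<open>A\<close> is
  kept general to serve both \<sigma> and \<open>\<beta>\<^sub>v\<close>.\<close>

lemma istep_root_sigma_swap:
  assumes A: "A \<subseteq> trms K \<times> trms K" "val_subst_closed K A"
  shows "istep K V A O root_sigma K \<subseteq> root_sigma K O istep K V A"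
proof -
  have tr: "t \<in> trms K" "t' \<in> trms K" if "(t, t') \<in> cstep K A" for t t'
    using cstep_trms[OF A(1) that] by auto
  have lamV: "Lam p \<in> V" if "p \<in> trms K" for p
    using that vals_V by auto
  have s1: "(App (App (Lam p) u) r, App (Lam (App p (lift r))) u) \<in> root_sigma K"
    if "p \<in> trms K" "u \<in> trms K" "r \<in> trms K" for p u r
    using that unfolding root_sigma_def root_sigma1_def by blast
  have s3: "(App v (App (Lam p) u), App (Lam (App (lift v) p)) u) \<in> root_sigma K"
    if "p \<in> trms K" "u \<in> trms K" "v \<in> vals K" for p u v
    using that unfolding root_sigma_def root_sigma3_def by blast
  have body: "(App (Lam q) u, App (Lam q') u) \<in> istep K V A"
    if "(q, q') \<in> cstep K A" "u \<in> trms K" for q q' u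
    using that by (auto intro: istep.intros)
  have arg: "(App (Lam q) u, App (Lam q) u') \<in> istep K V A"
    if "(u, u') \<in> istep K V A" "q \<in> trms K" for q u u'
    using that lamV by (auto intro: istep.intros)
  note lft = cstep_lift[OF A(2)]
  have "(t, w) \<in> root_sigma K O istep K V A"
    if i: "(t, u) \<in> istep K V A" and s: "(u, w) \<in> root_sigma K" for t u w
  proof -
    from s consider
      (1) p a r where "u = App (App (Lam p) a) r" "w = App (Lam (App p (lift r))) a"
        "p \<in> trms K" "a \<in> trms K" "r \<in> trms K"
    | (3) p a v where "u = App v (App (Lam p) a)" "w = App (Lam (App (lift v) p)) a"
        "p \<in> trms K" "a \<in> trms K" "v \<in> vals K"
      unfolding root_sigma_def root_sigma1_def root_sigma3_def by blast
    then show ?thesis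
    proof cases
      case 1
      have R: ?thesis if "t = App (App (Lam p) a) c" "(c, r) \<in> cstep K A" for c
      proof -
        have "(App (Lam (App p (lift c))) a, w) \<in> istep K V A"
          using 1 that by (auto intro!: body cstep.appR lft)
        then show ?thesis using s1 that 1 tr by blast
      qed
      from i[unfolded 1(1)] show ?thesis
      proof (cases rule: istep_to_App)
        case (left c)
        from left(2) show ?thesis
        proof (cases rule: istep_to_redex)
          case (left q)
          then have "(App (Lam (App q (lift r))) a, w) \<in> istep K V A"
            using 1 by (auto intro!: body cstep.appL)
          then show ?thesis using s1 left 1 tr \<open>t = App c r\<close> by blast
        next
          case (right d)
          then have "(App (Lam (App p (lift r))) d, w) \<in> istep K V A"
            using 1 by (auto intro!: arg)
          moreover have "d \<in> trms K" using tr(1) istep_cstep[OF right(2)] by blast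
          then have "(t, App (Lam (App p (lift r))) d) \<in> root_sigma K"
            using s1 right 1 \<open>t = App c r\<close> by simp
          ultimately show ?thesis by blast
        qed
      qed (use R istep_cstep in blast)+
    next
      case 3
      from i[unfolded 3(1)] show ?thesis
      proof (cases rule: istep_to_App)
        case (left c)
        \<comment> \<open>As internal steps create no values, \<open>c\<close> is a value already
          and the \<sigma>3 redex exists before the step.\<close>
        then have q: "c \<in> vals K" "(c, v) \<in> cstep K A"
          using istep_to_val[OF _ 3(5) A(1), of c] istep_cstep by blast+
        then have "(App (Lam (App (lift c) p)) a, w) \<in> istep K V A"
          using 3 by (auto intro!: body cstep.appL lft)
        then show ?thesis using s3 left 3 q by blast
      next
        case (right c)
        from right(2) show ?thesis
        proof (cases rule: istep_to_redex)
          case (left q)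
          then have "(App (Lam (App (lift v) q)) a, w) \<in> istep K V A"
            using 3 by (auto intro!: body cstep.appR simp: vals_trms)
          then show ?thesis using s3 left 3 tr \<open>t = App v c\<close> by blast
        next
          case (right d)
          then have "(App (Lam (App (lift v) p)) d, w) \<in> istep K V A"
            using 3 by (auto intro!: arg simp: vals_trms)
          moreover have "d \<in> trms K" using tr(1) istep_cstep[OF right(2)] by blast
          then have "(t, App (Lam (App (lift v) p)) d) \<in> root_sigma K"
            using s3 right 3 \<open>t = App v c\<close> by simp
          ultimately show ?thesis by blast
        qed
      next
        case (right_any c)
        then show ?thesis using 3 vals_V by blast
      qed
    qed
  qed
  then show ?thesis by blast
qed

text \<open>Lifts a root swap to evaluation contexts by induction on the evaluation step. The
  residual relation \<open>X\<close> stays abstract because it is an internal step, a full step or a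
  sequence of full steps, depending on the rules. The premises \<open>par1\<close> and
  \<open>par2\<close> treat disjoint steps, where evaluating the operator may alter the status of a
  step in the operand.\<close>

lemma istep_estep_swap:
  assumes R: "R \<subseteq> trms K \<times> trms K" and A: "A \<subseteq> trms K \<times> trms K"
    and root: "istep K V A O R \<subseteq> estep K V R O X"
    and sub: "istep K V A \<subseteq> X"
    and appL: "\<And>t t' u. (t, t') \<in> X \<Longrightarrow> u \<in> trms K \<Longrightarrow> (App t u, App t' u) \<in> X"
    and appR: "\<And>t u u'. (u, u') \<in> X \<Longrightarrow> t \<in> V \<Longrightarrow> (App t u, App t u') \<in> X"
    and par1: "\<And>t t' u u'. (t, t') \<in> estep K V R \<Longrightarrow> t \<in> V \<Longrightarrow> (u, u') \<in> istep K V A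
      \<Longrightarrow> (App t' u, App t' u') \<in> X"
    and par2: "\<And>t t' u u'. (t, t') \<in> estep K V R \<Longrightarrow> t \<notin> V \<Longrightarrow> (u, u') \<in> cstep K A
      \<Longrightarrow> (App t' u, App t' u') \<in> X"
  shows "istep K V A O estep K V R \<subseteq> estep K V R O X"
proof -
  have "(t, w) \<in> estep K V R O X" if "(u, w) \<in> estep K V R" "(t, u) \<in> istep K V A" for t u w
    using that
  proof (induction arbitrary: t)
    case (root u w)
    then show ?case using assms(3) by blast
  next
    case (appL a a' b)
    from appL.prems show ?case
    proof (cases rule: istep_to_App)
      case (left c)
      with appL.IH obtain d where "(c, d) \<in> estep K V R" "(d, a') \<in> X" by blast
      with left appL.hyps show ?thesis using assms(5) estep.appL by blast
    next
      case (right c)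
      then have "c \<in> trms K" using cstep_trms[OF A] istep_cstep by blast
      with right appL.hyps show ?thesis using par1 estep.appL by blast
    next
      case (right_any c)
      then have "c \<in> trms K" using cstep_trms[OF A] by blast
      with right_any appL.hyps show ?thesis using par2 estep.appL by blast
    qed
  next
    case (appR b b' a)
    from appR.prems show ?case
    proof (cases rule: istep_to_App)
      case (left c)
      \<comment> \<open>The internal step did not bring the operator into \<open>V\<close>, so the
        operand could be evaluated before it.\<close>
      then have "c \<in> V" using istep_to_V A appR.hyps by blast
      moreover have "b' \<in> trms K" using cstep_trms[OF R] estep_cstep appR.hyps by blast
      ultimately show ?thesis using left appR.hyps sub assms(5) estep.appR by blast
    next
      case (right c)
      with appR.IH obtain d where "(c, d) \<in> estep K V R" "(d, b') \<in> X" by blast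
      with right appR.hyps show ?thesis using assms(6) estep.appR by blast
    next
      case (right_any c)
      with appR.hyps show ?thesis by blast
    qed
  qed
  then show ?thesis by blast
qed

text \<open>Both \<sigma> rules produce an application, and so does any step inside an application.
  An operator reduced by \<sigma> therefore never becomes a value that would open its operand to
  evaluation.\<close>

lemma estep_sigma_not_val:
  assumes "(t, t') \<in> estep K V (root_sigma K)"
  shows "t' \<notin> vals K"
  using assms by (cases) (auto simp: root_sigma_def root_sigma1_def root_sigma3_def)

lemma istep_sigma_estep_sigma:
  "istep K V (root_sigma K) O estep K V (root_sigma K)
    \<subseteq> estep K V (root_sigma K) O istep K V (root_sigma K)"
proof (rule istep_estep_swap[OF root_sigma_trms root_sigma_trms])
  show "istep K V (root_sigma K) O root_sigma K \<subseteq> estep K V (root_sigma K) O istep K V (root_sigma K)"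
    using istep_root_sigma_swap[OF root_sigma_trms val_subst_closed_sigma] estep.root by blast
next
  fix t t' u u' :: "'c trm"
  assume e: "(t, t') \<in> estep K V (root_sigma K)"
  have t: "t \<in> trms K" "t' \<in> trms K" "t' \<notin> vals K"
    using cstep_trms[OF root_sigma_trms] estep_cstep e estep_sigma_not_val by blast+
  {
    assume "(u, u') \<in> istep K V (root_sigma K)"
    then show "(App t' u, App t' u') \<in> istep K V (root_sigma K)"
      using t istep_cstep by (cases "t' \<in> V") (blast intro: istep.intros)+
  next
    \<comment> \<open>Since \<open>t\<close> is a term, \<open>t \<notin> V\<close> forces
      \<open>V = vals K\<close>; as \<open>t'\<close> is no value, the operand step stays
      internal.\<close>
    assume "(u, u') \<in> cstep K (root_sigma K)" "t \<notin> V"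
    then show "(App t' u, App t' u') \<in> istep K V (root_sigma K)"
      using t V by (blast intro: istep.intros)
  }
qed (auto intro: istep.intros)

lemma istep_betav_estep_sigma:
  "istep K V (root_betav K) O estep K V (root_sigma K)
    \<subseteq> estep K V (root_sigma K) O cstep K (root_betav K)"
proof (rule istep_estep_swap[OF root_sigma_trms root_betav_trms])
  show "istep K V (root_betav K) O root_sigma K \<subseteq> estep K V (root_sigma K) O cstep K (root_betav K)"
    using istep_root_sigma_swap[OF root_betav_trms val_subst_closed_betav] estep.root istep_cstep
    by blast
next
  fix t t' u u' :: "'c trm"
  assume e: "(t, t') \<in> estep K V (root_sigma K)"
  have t: "t' \<in> trms K"
    using cstep_trms[OF root_sigma_trms] estep_cstep e by blast
  then show "(App t' u, App t' u') \<in> cstep K (root_betav K)"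
    if "(u, u') \<in> istep K V (root_betav K)" using that istep_cstep cstep.appR by blast
  from t show "(App t' u, App t' u') \<in> cstep K (root_betav K)"
    if "(u, u') \<in> cstep K (root_betav K)" using that cstep.appR by blast
qed (use V_trms in \<open>auto intro: cstep.intros istep_cstep\<close>)

text \<open>A \<sigma> step in the body survives instantiation as one step; a \<sigma> step in the
  argument starts from a value and is repeated for each occurrence of the bound variable.\<close>

lemma istep_sigma_root_betav:
  "istep K V (root_sigma K) O root_betav K \<subseteq> root_betav K O (cstep K (root_sigma K))\<^sup>*"
proof -
  have "(t, inst p v) \<in> root_betav K O (cstep K (root_sigma K))\<^sup>*"
    if i: "(t, App (Lam p) v) \<in> istep K V (root_sigma K)" and p: "p \<in> trms K" and v: "v \<in> vals K"
    for t p v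
    using i
  proof (cases rule: istep_to_redex)
    case (left q)
    then have "(inst q v, inst p v) \<in> cstep K (root_sigma K)"
      using v by (simp add: inst_def cstep_msubst[OF val_subst_closed_sigma])
    moreover have "(t, inst q v) \<in> root_betav K"
      using left v cstep_trms[OF root_sigma_trms] unfolding root_betav_def by blast
    ultimately show ?thesis by blast
  next
    case (right c)
    have c: "c \<in> vals K" using right v istep_to_val[OF _ _ root_sigma_trms] by metis
    have "(inst p c, inst p v) \<in> (cstep K (root_sigma K))\<^sup>*"
      unfolding inst_def
      by (rule cstep_rtrancl_msubst_pointwise[OF val_subst_closed_sigma])
        (use p c v right istep_cstep in \<open>auto split: nat.split\<close>)
    moreover have "(t, inst p c) \<in> root_betav K"
      using right c p unfolding root_betav_def by blast
    ultimately show ?thesis by blast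
  qed
  then show ?thesis unfolding root_betav_def by blast
qed

lemma istep_sigma_estep_betav:
  "istep K V (root_sigma K) O estep K V (root_betav K)
    \<subseteq> estep K V (root_betav K) O (cstep K (root_sigma K))\<^sup>*"
proof (rule istep_estep_swap[OF root_betav_trms root_sigma_trms])
  show "istep K V (root_sigma K) O root_betav K
      \<subseteq> estep K V (root_betav K) O (cstep K (root_sigma K))\<^sup>*"
    using istep_sigma_root_betav estep.root by blast
next
  fix t t' u u' :: "'c trm"
  assume e: "(t, t') \<in> estep K V (root_betav K)"
  have t: "t' \<in> trms K"
    using cstep_trms[OF root_betav_trms] estep_cstep e by blast
  then show "(App t' u, App t' u') \<in> (cstep K (root_sigma K))\<^sup>*"
    if "(u, u') \<in> istep K V (root_sigma K)" using that istep_cstep cstep.appR by blast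
  from t show "(App t' u, App t' u') \<in> (cstep K (root_sigma K))\<^sup>*"
    if "(u, u') \<in> cstep K (root_sigma K)" using that cstep.appR by blast
qed (use V_trms in \<open>auto intro: cstep_rtrancl_cong istep_cstep\<close>)

end

section \<open>Factorization of call-by-value beta\<close>

text \<open>Parallel \<open>\<beta>\<^sub>v\<close>-reduction: any selection of the redexes present
  in a term is contracted at once.\<close>

inductive_set par :: "'c set \<Rightarrow> 'c trm rel" for K where
  var: "(Var i, Var i) \<in> par K"
| const: "c \<in> K \<Longrightarrow> (Const c, Const c) \<in> par K"
| lam: "(t, t') \<in> par K \<Longrightarrow> (Lam t, Lam t') \<in> par K"
| app: "(t, t') \<in> par K \<Longrightarrow> (u, u') \<in> par K \<Longrightarrow> (App t u, App t' u') \<in> par K"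
| beta: "(t, t') \<in> par K \<Longrightarrow> (v, v') \<in> par K \<Longrightarrow> v \<in> vals K
    \<Longrightarrow> (App (Lam t) v, inst t' v') \<in> par K"

text \<open>Parallel reduction that contracts no redex in evaluation position; only below an
  abstraction or to the right of a term outside \<open>V\<close> is it unrestricted.\<close>

inductive_set ipar :: "'c set \<Rightarrow> 'c trm set \<Rightarrow> 'c trm rel" for K V where
  var: "(Var i, Var i) \<in> ipar K V"
| const: "c \<in> K \<Longrightarrow> (Const c, Const c) \<in> ipar K V"
| lam: "(t, t') \<in> par K \<Longrightarrow> (Lam t, Lam t') \<in> ipar K V"
| app: "(t, t') \<in> ipar K V \<Longrightarrow> (u, u') \<in> ipar K V \<Longrightarrow> (App t u, App t' u') \<in> ipar K V"
| app_any: "(t, t') \<in> ipar K V \<Longrightarrow> t \<notin> V \<Longrightarrow> (u, u') \<in> par K \<Longrightarrow> (App t u, App t' u') \<in> ipar K V"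

lemma par_refl: "t \<in> trms K \<Longrightarrow> (t, t) \<in> par K"
  by (induction rule: trms.induct) (auto intro: par.intros)

text \<open>A value is not an application, so all its redexes lie under an abstraction.\<close>

lemma par_from_val:
  assumes "(v, t) \<in> par K" "v \<in> vals K"
  shows "(v, t) \<in> ipar K V"
  using assms by (cases) (auto intro: ipar.intros)

lemma ipar_par: "(t, t') \<in> ipar K V \<Longrightarrow> (t, t') \<in> par K"
  by (induction rule: ipar.induct) (auto intro: par.intros)

lemma par_trms_vals:
  assumes "(t, t') \<in> par K"
  shows "t \<in> trms K \<and> t' \<in> trms K \<and> (t \<in> vals K \<longrightarrow> t' \<in> vals K)"
  using assms by induction (auto simp: vals_trms)

lemma ipar_vals_iff:
  assumes "(t, t') \<in> ipar K V"
  shows "t' \<in> vals K \<longleftrightarrow> t \<in> vals K"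
  using assms par_trms_vals by cases auto

lemma par_rename: "(t, t') \<in> par K \<Longrightarrow> (rename f t, rename f t') \<in> par K"
proof (induction arbitrary: f rule: par.induct)
  case (beta t t' v v')
  then show ?case by (auto simp: rename_inst intro: par.beta rename_vals)
qed (auto intro: par.intros)

lemma par_up:
  "(\<And>i. (s i, s' i) \<in> par K) \<Longrightarrow> (up s i, up s' i) \<in> par K"
  by (auto split: nat.split intro: par.intros par_rename simp: lift_def)

text \<open>Replacing variables by values keeps the arguments of the contracted redexes values, so
  those redexes can still be fired.\<close>

lemma par_msubst:
  assumes "(t, t') \<in> par K" "val_subst K s" "\<And>i. (s i, s' i) \<in> par K"
  shows "(msubst s t, msubst s' t') \<in> par K"
  using assms
proof (induction arbitrary: s s' rule: par.induct)
  case (lam t t')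
  then have "(msubst (up s) t, msubst (up s') t') \<in> par K"
    by (intro lam.IH val_subst_up par_up)
  then show ?case by (simp add: par.lam)
next
  case (beta t t' v v')
  have "(msubst (up s) t, msubst (up s') t') \<in> par K"
    by (intro beta.IH val_subst_up par_up beta.prems)
  then show ?case using beta by (auto simp: msubst_inst intro!: par.beta)
qed (auto intro: par.intros)

section \<open>Splitting and merging of parallel steps\<close>

context evaluation
begin

lemma ipar_V_iff:
  assumes "(t, t') \<in> ipar K V"
  shows "t' \<in> V \<longleftrightarrow> t \<in> V"
  using V ipar_vals_iff[OF assms] par_trms_vals[OF ipar_par[OF assms]] by auto

text \<open>Parallel reduction of the substituted terms is harmless even in evaluation position:
  they are values, and from a value it is internal.\<close>

lemma ipar_msubst:
  assumes "(t, t') \<in> ipar K V" "val_subst K s" "\<And>i. (s i, s' i) \<in> par K"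
  shows "(msubst s t, msubst s' t') \<in> ipar K V"
  using assms(1)
proof induction
  case (var i)
  then show ?case using assms(2,3) by (auto intro: par_from_val val_substD)
next
  case (lam t t')
  then have "(msubst (up s) t, msubst (up s') t') \<in> par K"
    by (intro par_msubst val_subst_up par_up assms(2,3))
  then show ?case by (simp add: ipar.lam)
next
  case (app_any t t' u u')
  then have "t \<in> trms K" using par_trms_vals ipar_par by blast
  with app_any show ?case using assms(2)
    by (auto intro!: ipar.app_any par_msubst assms(3) simp: msubst_V_iff)
qed (auto intro: ipar.intros)

lemma estep_rtrancl_msubst:
  assumes "(t, t') \<in> (estep K V (root_betav K))\<^sup>*" "val_subst K s"
  shows "(msubst s t, msubst s t') \<in> (estep K V (root_betav K))\<^sup>*"
  using assms(1)
  by induction (auto intro: rtrancl_into_rtrancl estep_msubst[OF val_subst_closed_betav _ assms(2)])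

lemma estep_rtrancl_appL:
  "(t, t') \<in> (estep K V R)\<^sup>* \<Longrightarrow> u \<in> trms K \<Longrightarrow> (App t u, App t' u) \<in> (estep K V R)\<^sup>*"
  by (induction rule: rtrancl_induct) (auto intro: rtrancl_into_rtrancl estep.appL)

lemma estep_rtrancl_appR:
  "(u, u') \<in> (estep K V R)\<^sup>* \<Longrightarrow> t \<in> V \<Longrightarrow> (App t u, App t u') \<in> (estep K V R)\<^sup>*"
  by (induction rule: rtrancl_induct) (auto intro: rtrancl_into_rtrancl estep.appR)

text \<open>Structural induction on the parallel step suffices. For a redex, first contract it, then
  evaluate the body under the substitution, and finish internally, since reducing the substituted
  value adds no evaluation steps.\<close>

lemma par_split:
  assumes "(t, t') \<in> par K"
  shows "(t, t') \<in> (estep K V (root_betav K))\<^sup>* O ipar K V"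
  using assms
proof induction
  case (app t t' u u')
  then obtain a b where ab: "(t, a) \<in> (estep K V (root_betav K))\<^sup>*" "(a, t') \<in> ipar K V"
    "(u, b) \<in> (estep K V (root_betav K))\<^sup>*" "(b, u') \<in> ipar K V" by blast
  have u: "u \<in> trms K" using app par_trms_vals by blast
  note 1 = estep_rtrancl_appL[OF ab(1) u]
  show ?case
  \<comment> \<open>If the evaluated operator lies in \<open>V\<close>, the operand is evaluated
    next; otherwise its entire parallel step already counts as internal.\<close>
  proof (cases "a \<in> V")
    case True
    then have "(App t u, App a b) \<in> (estep K V (root_betav K))\<^sup>*"
      using 1 estep_rtrancl_appR[OF ab(3) True] by (meson rtrancl_trans)
    then show ?thesis using ab ipar.app by blast
  next
    case False
    then show ?thesis using ab app.hyps 1 ipar.app_any by blast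
  qed
next
  case (beta t t' v v')
  then obtain a where a: "(t, a) \<in> (estep K V (root_betav K))\<^sup>*" "(a, t') \<in> ipar K V" by blast
  have "(App (Lam t) v, inst t v) \<in> root_betav K"
    using beta par_trms_vals unfolding root_betav_def by blast
  then have "(App (Lam t) v, inst t v) \<in> estep K V (root_betav K)" by (rule estep.root)
  moreover have "(inst t v, inst a v) \<in> (estep K V (root_betav K))\<^sup>*"
    unfolding inst_def using a beta by (auto intro: estep_rtrancl_msubst)
  moreover have "(inst a v, inst t' v') \<in> ipar K V"
    unfolding inst_def using a beta
    by (auto intro!: ipar_msubst par.var split: nat.split)
  ultimately show ?case by (meson converse_rtrancl_into_rtrancl relcomp.intros)
qed (blast intro: ipar.intros)+

lemma ipar_to_App:
  assumes "(t, App a b) \<in> ipar K V"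
  obtains c d where "t = App c d" "(c, a) \<in> ipar K V" "(d, b) \<in> par K"
    "a \<in> V \<Longrightarrow> (d, b) \<in> ipar K V"
  using assms by (cases rule: ipar.cases) (auto simp: ipar_V_iff ipar_par)

text \<open>Internal parallel reduction creates no evaluation redex: the one contracted afterwards
  has an ancestor in the source, which a parallel step can contract together with the
  others.\<close>

lemma ipar_estep_merge:
  assumes "(u, w) \<in> estep K V (root_betav K)" "(t, u) \<in> ipar K V"
  shows "(t, w) \<in> par K"
  using assms
proof (induction arbitrary: t)
  case (root u w)
  then obtain p v where p: "u = App (Lam p) v" "w = inst p v" "p \<in> trms K" "v \<in> vals K"
    unfolding root_betav_def by blast
  \<comment> \<open>Having the operator in \<open>V\<close> forces the argument to reduce
    internally, and hence to be a value from the start.\<close>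
  then have "Lam p \<in> V" using vals_V by auto
  with root.prems p obtain c d where cd: "t = App c d" "(c, Lam p) \<in> ipar K V" "(d, v) \<in> ipar K V"
    by (auto elim: ipar_to_App)
  from cd(2) obtain q where "c = Lam q" "(q, p) \<in> par K" by (auto elim: ipar.cases)
  then show ?case using cd p ipar_vals_iff ipar_par par.beta by metis
next
  case (appL a a' b)
  from appL.prems show ?case
    by (rule ipar_to_App) (auto intro: par.app appL.IH)
next
  case (appR b b' a)
  from appR.prems show ?case
    by (rule ipar_to_App) (use appR.hyps in \<open>auto intro: par.app appR.IH ipar_par\<close>)
qed

section \<open>Parallel reduction compared with single steps\<close>

lemma ipar_refl:
  assumes "t \<in> trms K"
  shows "(t, t) \<in> ipar K V"
  using assms by induction (auto intro: ipar.intros par_refl)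

lemma cstep_betav_par:
  assumes "(t, t') \<in> cstep K (root_betav K)"
  shows "(t, t') \<in> par K"
  using assms
  by induction (auto intro: par.lam par.app par.beta par_refl vals_trms simp: root_betav_def)

lemma istep_betav_ipar:
  assumes "(t, t') \<in> istep K V (root_betav K)"
  shows "(t, t') \<in> ipar K V"
  using assms
  by induction (use V_trms in \<open>auto intro: ipar.intros ipar_refl cstep_betav_par\<close>)

lemma par_cstep_betav:
  assumes "(t, t') \<in> par K"
  shows "(t, t') \<in> (cstep K (root_betav K))\<^sup>*"
  using assms
proof induction
  case (lam t t')
  then show ?case by (simp add: cstep_rtrancl_cong)
next
  case (app t t' u u')
  then show ?case using par_trms_vals by (meson cstep_rtrancl_cong(2,3) rtrancl_trans)
next
  case (beta t t' v v')
  have tr: "t \<in> trms K" "t' \<in> trms K" "v \<in> trms K" "v' \<in> vals K"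
    using beta par_trms_vals by blast+
  then have "(App (Lam t) v, App (Lam t') v') \<in> (cstep K (root_betav K))\<^sup>*"
    using beta by (meson cstep_rtrancl_cong rtrancl_trans trms_iff(2))
  moreover have "(App (Lam t') v', inst t' v') \<in> cstep K (root_betav K)"
    using tr by (auto intro!: cstep.root simp: root_betav_def)
  ultimately show ?case by (rule rtrancl_into_rtrancl)
qed auto

lemma istep_rtrancl_lam:
  "(t, t') \<in> (cstep K R)\<^sup>* \<Longrightarrow> (Lam t, Lam t') \<in> (istep K V R)\<^sup>*"
  by (induction rule: rtrancl_induct) (auto intro: rtrancl_into_rtrancl istep.lam)

lemma istep_rtrancl_appL:
  "(t, t') \<in> (istep K V R)\<^sup>* \<Longrightarrow> u \<in> trms K \<Longrightarrow> (App t u, App t' u) \<in> (istep K V R)\<^sup>*"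
  by (induction rule: rtrancl_induct) (auto intro: rtrancl_into_rtrancl istep.appL)

lemma istep_rtrancl_appR:
  assumes "(u, u') \<in> (istep K V R)\<^sup>*" "t \<in> trms K"
  shows "(App t u, App t u') \<in> (istep K V R)\<^sup>*"
  using assms(1)
proof induction
  case (step y z)
  then have "(App t y, App t z) \<in> istep K V R"
    using assms(2) istep_cstep by (cases "t \<in> V") (blast intro: istep.intros)+
  with step show ?case by (meson rtrancl_into_rtrancl)
qed simp

lemma istep_rtrancl_appR_any:
  "(u, u') \<in> (cstep K R)\<^sup>* \<Longrightarrow> t \<in> trms K \<Longrightarrow> t \<notin> V \<Longrightarrow> (App t u, App t u') \<in> (istep K V R)\<^sup>*"
  by (induction rule: rtrancl_induct) (auto intro: rtrancl_into_rtrancl istep.appR_any)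

lemma ipar_istep_betav:
  assumes "(t, t') \<in> ipar K V"
  shows "(t, t') \<in> (istep K V (root_betav K))\<^sup>*"
  using assms
proof induction
  case (lam t t')
  then show ?case by (simp add: istep_rtrancl_lam par_cstep_betav)
next
  case (app t t' u u')
  then show ?case using par_trms_vals ipar_par
    by (meson istep_rtrancl_appL istep_rtrancl_appR rtrancl_trans)
next
  case (app_any t t' u u')
  \<comment> \<open>The operator is reduced first and remains outside \<open>V\<close>, so all later
    steps in the operand are internal.\<close>
  then have "t' \<notin> V" "t' \<in> trms K" "u \<in> trms K"
    using ipar_V_iff par_trms_vals ipar_par by blast+
  then show ?case using app_any
    by (meson istep_rtrancl_appL istep_rtrancl_appR_any par_cstep_betav rtrancl_trans)
qed auto

lemma betav_factorization:
  "(estep K V (root_betav K) \<union> istep K V (root_betav K))\<^sup>*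
    \<subseteq> (estep K V (root_betav K))\<^sup>* O (istep K V (root_betav K))\<^sup>*"
proof -
  let ?E = "estep K V (root_betav K)" and ?I = "istep K V (root_betav K)"
  \<comment> \<open>Merging into one parallel step and splitting it again postpones the internal
    part as a single step.\<close>
  have "ipar K V O ?E \<subseteq> ?E\<^sup>* O ipar K V"
    using ipar_estep_merge par_split by blast
  then have "(?E \<union> ipar K V)\<^sup>* \<subseteq> ?E\<^sup>* O (ipar K V)\<^sup>*"
    by (rule factorization_if_postpone)
  moreover have "(?E \<union> ?I)\<^sup>* \<subseteq> (?E \<union> ipar K V)\<^sup>*"
    by (rule rtrancl_mono) (auto intro: istep_betav_ipar)
  moreover have "(ipar K V)\<^sup>* \<subseteq> ?I\<^sup>*"
    by (rule rtrancl_subset_rtrancl) (auto intro: ipar_istep_betav)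
  ultimately show ?thesis by blast
qed

section \<open>Factorization of \<sigma> and of the union\<close>

lemma sigma_factorization:
  "(estep K V (root_sigma K) \<union> istep K V (root_sigma K))\<^sup>*
    \<subseteq> (estep K V (root_sigma K))\<^sup>* O (istep K V (root_sigma K))\<^sup>*"
  by (rule factorization_if_postpone) (use istep_sigma_estep_sigma in blast)

lemma shuffling_factorization:
  "(cstep K (root_betav K) \<union> cstep K (root_sigma K))\<^sup>*
    \<subseteq> (estep K V (root_betav K) \<union> estep K V (root_sigma K))\<^sup>*
      O (istep K V (root_betav K) \<union> istep K V (root_sigma K))\<^sup>*"
proof -
  \<comment> \<open>The residual full step is itself an evaluation or an internal step, which gives
    the form of the linear swap.\<close>
  have "istep K V (root_betav K) O estep K V (root_sigma K)
      \<subseteq> estep K V (root_sigma K) O (estep K V (root_betav K) \<union> istep K V (root_betav K))\<^sup>*"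
    using istep_betav_estep_sigma[unfolded cstep_split]
    by (rule subset_trans) (rule relcomp_mono[OF subset_refl r_into_rtrancl[THEN subrelI]])
  moreover have "istep K V (root_sigma K) O estep K V (root_betav K)
      \<subseteq> estep K V (root_betav K) O (estep K V (root_sigma K) \<union> istep K V (root_sigma K))\<^sup>*"
    using istep_sigma_estep_betav unfolding cstep_split .
  ultimately show ?thesis
    using modular_factorization[OF betav_factorization sigma_factorization]
    unfolding cstep_split by (simp add: Un_ac)
qed

end

theorem theorem7p2:
  fixes K :: "'c set" and E :: "'c ctx set"
  assumes "E \<in> {left_ctxs K, weak_ctxs K}"
  shows "(step K (root_sigma K))\<^sup>*
           \<subseteq> (closure E (root_sigma K))\<^sup>* O (nonstep K E (root_sigma K))\<^sup>*
       \<and> nonstep K E (root_betav K) O root_sigma K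
           \<subseteq> closure E (root_sigma K) O step K (root_betav K)
       \<and> (\<forall>R \<in> {root_sigma1 K, root_sigma3 K}. \<forall>t t' x. \<forall>v \<in> vals K.
           (t, t') \<in> R \<longrightarrow> (subst t x v, subst t' x v) \<in> R)
       \<and> (step_sh K)\<^sup>*
           \<subseteq> (closure E (root_betav K) \<union> closure E (root_sigma K))\<^sup>*
             O (nonstep K E (root_betav K) \<union> nonstep K E (root_sigma K))\<^sup>*"
proof -
  obtain V where V: "V = vals K \<or> V = trms K" and E: "E = ectxs K V"
    using assms by (auto simp: left_ctxs_eq weak_ctxs_eq)
  interpret evaluation K V using V by unfold_locales
  have e: "closure E R = estep K V R" and i: "nonstep K E R = istep K V R" for R
    unfolding E by (rule closure_ectxs_eq, rule nonstep_eq[OF V_trms])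
  \<comment> \<open>Single substitution fixes every other variable, and variables are values, so it
    is a substitution of values.\<close>
  have "val_subst K (Var(x := v))" if "v \<in> vals K" for x v
    using that by (simp add: val_subst_def)
  then have "\<forall>R \<in> {root_sigma1 K, root_sigma3 K}. \<forall>t t' x. \<forall>v \<in> vals K.
      (t, t') \<in> R \<longrightarrow> (subst t x v, subst t' x v) \<in> R"
    by (auto simp: subst_def intro: val_subst_closedD[OF val_subst_closed_sigma1]
      val_subst_closedD[OF val_subst_closed_sigma3])
  moreover have "(step K (root_sigma K))\<^sup>*
      \<subseteq> (estep K V (root_sigma K))\<^sup>* O (istep K V (root_sigma K))\<^sup>*"
    using sigma_factorization unfolding step_eq cstep_split .
  moreover have "istep K V (root_betav K) O root_sigma K
      \<subseteq> estep K V (root_sigma K) O step K (root_betav K)"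
    unfolding step_eq
    \<comment> \<open>A root step is an evaluation step in the empty context, so the swap for
      evaluation steps applies.\<close>
    by (rule subset_trans[OF relcomp_mono[OF subset_refl] istep_betav_estep_sigma])
      (auto intro: estep.root)
  ultimately show ?thesis
    using shuffling_factorization unfolding e i step_sh_def step_eq by (intro conjI)
qed

end
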